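(* Let $G$ be a finite, simple, connected outerplanar graph. If $G$ is a tree then $c_{cr}(G)=1$; otherwise $c_{cr}(G)=2$.
   Context: A graph is outerplanar if it can be drawn in the plane so that its vertices are arranged on a circle and all edges are placed on or outside of the circle with no crossing edges. Cheating Robot game on a finite, simple, connected graph $G$ with $k$ cops: first the cop player places $k$ cops on vertices of $G$, then the robot is placed on a vertex. A vertex may hold more than one token. Play then proceeds in rounds: in each round, first every cop moves to a vertex in its closed neighbourhood (so a cop may stay put), and then the robot, knowing the cops' moves, moves to a vertex in his closed neighbourhood (he may stay put). Both sides have perfect information about positions. The robot is captured if either (i) at the end of the robot's move a cop and the robot are on the same vertex, or (ii) on his move the robot traverses an edge that a cop traversed on the cops' immediately preceding move. (A cop moving onto the robot's vertex does not by itself end the game; the robot still gets his move.) The cops win if they capture the robot after finitely many rounds. $c_{cr}(G)$ is the least number of cops that have a strategy guaranteeing capture of the robot on $G$. *)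

theory Defs
  imports "HOL-Analysis.Analysis" "Graph_Theory.Digraph_Component"
begin

text \<open>
  Finite simple graphs are \<open>pair_graph\<close>s of the Graph_Theory library: finite loop-free symmetric
  digraphs, in which an undirected edge is a pair of opposite arcs.
\<close>

definition edges :: "'a pair_pre_digraph \<Rightarrow> 'a set set" where
  "edges G = {{u, v} | u v. (u, v) \<in> parcs G}"

definition closed_nbhd :: "'a pair_pre_digraph \<Rightarrow> 'a \<Rightarrow> 'a set" where
  "closed_nbhd G v = insert v {w. (v, w) \<in> parcs G}"

text \<open>
  The library's \<^const>\<open>tree\<close> is not suitable here: it counts \<open>u, v, u\<close> as a cycle, so that no
  symmetric digraph with an arc would be a tree. Cycles of an undirected graph have length at
  least 3.
\<close>

definition undirected_tree :: "'a pair_pre_digraph \<Rightarrow> bool" where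
  "undirected_tree G \<longleftrightarrow> Digraph_Component.connected (with_proj G) \<and>
     \<not> (\<exists>p. pre_digraph.cycle (with_proj G) p \<and> 3 \<le> length p)"


text \<open>
  A drawing in the plane (here \<^typ>\<open>complex\<close>): \<open>p\<close> places the vertices on the circle and \<open>\<gamma>\<close> gives
  for each undirected edge a simple arc avoiding the open disc. As usual in drawings, an
  edge meets no vertices other than its ends, and distinct edges meet only in common ends.
\<close>

definition outerplanar_drawing ::
  "'a pair_pre_digraph \<Rightarrow> complex \<Rightarrow> real \<Rightarrow> ('a \<Rightarrow> complex) \<Rightarrow> ('a set \<Rightarrow> real \<Rightarrow> complex) \<Rightarrow> bool" where
  "outerplanar_drawing G z r p \<gamma> \<longleftrightarrow>
     0 < r \<and>
     inj_on p (pverts G) \<and> p ` pverts G \<subseteq> sphere z r \<and>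
     (\<forall>e \<in> edges G.
        arc (\<gamma> e) \<and>
        {pathstart (\<gamma> e), pathfinish (\<gamma> e)} = p ` e \<and>
        path_image (\<gamma> e) \<inter> ball z r = {} \<and>
        path_image (\<gamma> e) \<inter> p ` pverts G = p ` e) \<and>
     (\<forall>e \<in> edges G. \<forall>f \<in> edges G. e \<noteq> f \<longrightarrow>
        path_image (\<gamma> e) \<inter> path_image (\<gamma> f) \<subseteq> p ` (e \<inter> f))"

definition outerplanar :: "'a pair_pre_digraph \<Rightarrow> bool" where
  "outerplanar G \<longleftrightarrow> (\<exists>z r p \<gamma>. outerplanar_drawing G z r p \<gamma>)"


text \<open>
  A robot play \<open>R\<close> lists the robot's positions: \<open>R 0\<close> is his initial vertex and \<open>R (Suc t)\<close> his
  vertex after round \<open>Suc t\<close>.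
\<close>

definition robot_play :: "'a pair_pre_digraph \<Rightarrow> (nat \<Rightarrow> 'a) \<Rightarrow> bool" where
  "robot_play G R \<longleftrightarrow> R 0 \<in> pverts G \<and> (\<forall>t. R (Suc t) \<in> closed_nbhd G (R t))"

text \<open>
  A cop strategy maps the robot's past positions to the cops' next positions, the cops being
  numbered \<open>0, \<dots>, k - 1\<close>; the empty history gives their initial placement. (The cops' own
  past positions are determined by the strategy and the robot's past positions.)
\<close>

type_synonym 'a cop_strategy = "'a list \<Rightarrow> nat \<Rightarrow> 'a"

definition cop_positions :: "'a cop_strategy \<Rightarrow> (nat \<Rightarrow> 'a) \<Rightarrow> nat \<Rightarrow> nat \<Rightarrow> 'a" where
  "cop_positions S R t = S (map R [0..<t])"

definition legal_strategy :: "'a pair_pre_digraph \<Rightarrow> nat \<Rightarrow> 'a cop_strategy \<Rightarrow> bool" where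
  "legal_strategy G k S \<longleftrightarrow>
     (\<forall>R. robot_play G R \<longrightarrow> (\<forall>i<k.
        cop_positions S R 0 i \<in> pverts G \<and>
        (\<forall>t. cop_positions S R (Suc t) i \<in> closed_nbhd G (cop_positions S R t i))))"

text \<open>
  Capture in round \<open>Suc t\<close>, where \<open>C t i\<close> is the position of cop \<open>i\<close> after round \<open>t\<close>. Under
  \<open>R t \<noteq> R (Suc t)\<close>, the set equation says that the robot and cop \<open>i\<close> both moved along the same
  edge, in the same or in opposite directions.
\<close>

definition captured_in_round ::
  "nat \<Rightarrow> (nat \<Rightarrow> nat \<Rightarrow> 'a) \<Rightarrow> (nat \<Rightarrow> 'a) \<Rightarrow> nat \<Rightarrow> bool" where
  "captured_in_round k C R t \<longleftrightarrow>
     (\<exists>i<k. C (Suc t) i = R (Suc t) \<or>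
            R t \<noteq> R (Suc t) \<and> {R t, R (Suc t)} = {C t i, C (Suc t) i})"

definition winning_strategy :: "'a pair_pre_digraph \<Rightarrow> nat \<Rightarrow> 'a cop_strategy \<Rightarrow> bool" where
  "winning_strategy G k S \<longleftrightarrow> legal_strategy G k S \<and>
     (\<forall>R. robot_play G R \<longrightarrow> (\<exists>t. captured_in_round k (cop_positions S R) R t))"

definition c_cr :: "'a pair_pre_digraph \<Rightarrow> nat" where
  "c_cr G = (LEAST k. \<exists>S. winning_strategy G k S)"

end

theory Submission
  imports Defs
begin

text \<open>
  If \<open>G\<close> contains a cycle, one cop is not enough: the robot stays on the cycle, and whenever the
  cop steps onto his vertex he leaves by a cycle edge other than the one that the cop used
  (\<open>robot_evades_one_cop\<close>). On a tree one cop wins by always stepping towards the robot, which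
  shrinks the component that the robot is confined to (\<open>one_cop_wins_tree\<close>).

  For two cops on an outerplanar graph, the drawing is used only for its combinatorial content: in the
  order of the vertices around the circle no two edges have alternating ends
  (\<open>outerplanar_noncrossing\<close>, from the Jordan curve theorem). Cut open at a point, the circle
  becomes a line, and the cops confine the robot to an open interval of vertices that can be left
  only by its ends, which the cops occupy as far as necessary. An interval that is left by both
  ends can be shrunk: each end has a neighbour inside, and the guard of one end advances to
  its farthest inner neighbour if the robot is beyond that vertex. If neither guard can do so, then,
  edges being noncrossing, both of these neighbours are the robot's vertex \<open>r\<close>. Both
  cops then move to \<open>r\<close>; the robot can neither stay nor use the edges by which they came, so he
  is driven to one side of \<open>r\<close>, and the cop from that end goes back to it while the other one holds \<open>r\<close>
  (\<open>step_two_guards\<close>). An interval that is left by one end only is guarded by one cop; the other one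
  walks to that same end, and a similar argument applies (\<open>step_one_guard\<close>). By
  connectedness these are all cases.

  Winning is expressed by backward induction on positions and turned into a history-dependent
  strategy by \<open>cops_win_imp_winning_strategy\<close>.
\<close>

section \<open>From outerplanar drawings to noncrossing orders\<close>

lemma connected_insert_closure:
  assumes "Topological_Spaces.connected S" "b \<in> closure S"
  shows "Topological_Spaces.connected (insert b S)"
proof (rule connected_intermediate_closure[OF assms(1)])
  show "S \<subseteq> insert b S" by blast
  show "insert b S \<subseteq> closure S" using assms(2) closure_subset[of S] by blast
qed

lemma open_chord_subset_ball:
  fixes a c z :: complex
  assumes "a \<in> sphere z r" "c \<in> sphere z r" "a \<noteq> c"
  shows "closed_segment a c - {a, c} \<subseteq> ball z r"
proof
  fix w assume w: "w \<in> closed_segment a c - {a, c}"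
  then have "w \<in> open_segment a c" by (simp add: open_segment_def)
  from dist_decreases_open_segment[OF this, of z] assms show "w \<in> ball z r" by auto
qed

text \<open>
  Closing \<open>g\<close> by the chord from \<open>c\<close> to \<open>a\<close> gives a Jordan curve. The two open half-discs beside
  the chord are joined by \<open>h\<close>, so a connected set that misses the curve contains all points of the
  disc off the chord. But near an inner point of the chord there are points from both sides of
  the Jordan curve. The half-discs are cut out by \<open>inner n w < k\<close> and \<open>inner n w > k\<close>. Touching
  the circle elsewhere is permitted for \<open>g\<close> and \<open>h\<close>.
\<close>

lemma no_crossing_outside_disc:
  fixes z :: complex
  assumes "arc g" "pathstart g = a" "pathfinish g = c" "path_image g \<inter> ball z r = {}"
    and "arc h" "pathstart h = b" "pathfinish h = d" "path_image h \<inter> ball z r = {}"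
    and on: "a \<in> sphere z r" "b \<in> sphere z r" "c \<in> sphere z r" "d \<in> sphere z r"
    and r: "0 < r" and ac: "a \<noteq> c"
    and disj: "path_image g \<inter> path_image h = {}"
    and sides: "inner n a = k" "inner n c = k" "inner n b < k" "k < inner n d"
  shows False
proof -
  have acg: "a \<in> path_image g" "c \<in> path_image g" and bdh: "b \<in> path_image h" "d \<in> path_image h"
    using assms pathstart_in_path_image pathfinish_in_path_image by blast+
  define J where "J = path_image g \<union> closed_segment a c"
  have chord: "closed_segment a c - {a, c} \<subseteq> ball z r"
    using open_chord_subset_ball on(1,3) ac by blast
  have loop: "simple_path (g +++ linepath c a)"
    using assms(1-4) ac chord
    by (intro simple_path_join_loop) (auto simp: closed_segment_commute)
  have image: "path_image (g +++ linepath c a) = J"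
    using assms(3) by (simp add: J_def path_image_join closed_segment_commute)
  have ends: "pathfinish (g +++ linepath c a) = pathstart (g +++ linepath c a)"
    using assms(2) by simp
  note Jordan = Jordan_inside_outside[OF loop ends, unfolded image]
  \<comment> \<open>the open half-discs on the two sides of the chord\<close>
  define L where "L = ball z r \<inter> {w. inner n w < k}"
  define U where "U = ball z r \<inter> {w. k < inner n w}"
  have line: "inner n w = k" if w: "w \<in> closed_segment a c" for w
  proof -
    obtain u where "w = (1 - u) *\<^sub>R a + u *\<^sub>R c"
      using w by (auto simp: closed_segment_def)
    then have "inner n w = (1 - u) * k + u * k" using sides(1,2) by (simp add: inner_simps)
    then show ?thesis by (simp add: algebra_simps)
  qed
  have "b \<in> {w. inner n w < k} \<inter> closure (ball z r)"
    using on(2) sides(3) r by simp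
  moreover have "{w. inner n w < k} \<inter> closure (ball z r) \<subseteq> closure L"
    unfolding L_def Int_commute[of "ball z r"] by (intro open_Int_closure_subset open_halfspace_lt)
  moreover have "convex L"
    unfolding L_def by (intro convex_Int convex_ball convex_halfspace_lt)
  ultimately have conn_L: "Topological_Spaces.connected (insert b L)"
    using connected_insert_closure convex_connected by blast
  have "d \<in> {w. inner n w > k} \<inter> closure (ball z r)"
    using on(4) sides(4) r by simp
  moreover have "{w. inner n w > k} \<inter> closure (ball z r) \<subseteq> closure U"
    unfolding U_def Int_commute[of "ball z r"] by (intro open_Int_closure_subset open_halfspace_gt)
  moreover have "convex U"
    unfolding U_def by (intro convex_Int convex_ball convex_halfspace_gt)
  ultimately have conn_U: "Topological_Spaces.connected (insert d U)"
    using connected_insert_closure convex_connected by blast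
  define K where "K = insert b L \<union> path_image h \<union> insert d U"
  have "Topological_Spaces.connected K"
    unfolding K_def using conn_L conn_U bdh connected_arc_image[OF \<open>arc h\<close>]
    by (intro connected_Un) blast+
  have seg_h: "closed_segment a c \<inter> path_image h = {}"
    using chord assms(8) acg disj by blast
  have "insert b L \<inter> closed_segment a c = {}" "insert d U \<inter> closed_segment a c = {}"
    using line sides(3,4) unfolding L_def U_def by force+
  moreover have "insert b L \<inter> path_image g = {}" "insert d U \<inter> path_image g = {}"
    using bdh disj assms(4) unfolding L_def U_def by blast+
  ultimately have "K \<inter> J = {}"
    using seg_h disj unfolding K_def J_def by blast
  have mid: "midpoint a c \<in> J \<inter> ball z r"
  proof -
    have "midpoint a c \<in> closed_segment a c - {a, c}"
      using ac by simp
    with chord show ?thesis unfolding J_def by blast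
  qed
  have meets: "K \<inter> S \<noteq> {}" if "open S" "frontier S = J" for S
  proof -
    have "midpoint a c \<in> ball z r \<inter> closure S"
      using mid that(2) by (auto simp: frontier_def)
    then have "ball z r \<inter> S \<noteq> {}"
      using open_Int_closure_eq_empty[of "ball z r" S] by blast
    \<comment> \<open>a nonempty open set is not contained in the line through the chord\<close>
    moreover have "interior {w. inner n w = k} = {}"
      using sides by (intro interior_hyperplane) auto
    then have "\<not> ball z r \<inter> S \<subseteq> {w. inner n w = k}" if "ball z r \<inter> S \<noteq> {}"
      using interior_maximal[of "ball z r \<inter> S"] \<open>open S\<close> that by blast
    ultimately obtain w where "w \<in> ball z r" "w \<in> S" "inner n w \<noteq> k" by blast
    then have "w \<in> L \<union> U" by (auto simp: L_def U_def)
    with \<open>w \<in> S\<close> show ?thesis unfolding K_def by blast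
  qed
  have "K \<inter> inside J \<noteq> {}" "K - inside J \<noteq> {}"
    using meets[of "inside J"] meets[of "outside J"] Jordan by blast+
  then have "K \<inter> frontier (inside J) \<noteq> {}"
    using connected_Int_frontier \<open>Topological_Spaces.connected K\<close> by blast
  with Jordan \<open>K \<inter> J = {}\<close> show False by simp
qed

lemma circle_chord_sides:
  fixes z :: complex
  assumes "0 < r" "0 \<le> s" "s < t" "t < u" "u < v" "v < 2 * pi"
  defines "P \<equiv> \<lambda>s. z + of_real r * cis s"
  shows "\<exists>n k. inner n (P s) = k \<and> inner n (P u) = k \<and> inner n (P t) < k \<and> k < inner n (P v)"
proof -
  \<comment> \<open>The normal vector is the negative of the direction of the middle of the arc from s to u.\<close>
  define m where "m = (s + u) / 2"
  define \<delta> where "\<delta> = (u - s) / 2"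
  have inner_P: "inner (- cis m) (P \<tau>) = - inner (cis m) z - r * cos (\<tau> - m)" for \<tau>
    by (simp add: P_def inner_complex_def cos_diff algebra_simps)
  have "cos \<delta> < cos (t - m)"
  proof -
    have "\<bar>t - m\<bar> < \<delta>" "\<delta> \<le> pi"
      using assms by (simp_all add: m_def \<delta>_def abs_less_iff field_simps)
    then have "cos \<delta> < cos \<bar>t - m\<bar>" by (intro cos_monotone_0_pi) auto
    then show ?thesis by simp
  qed
  moreover have "cos (v - m) < cos \<delta>"
  proof (cases "v - m \<le> pi")
    case True
    moreover have "0 \<le> \<delta>" "\<delta> < v - m" using assms by (simp_all add: m_def \<delta>_def field_simps)
    ultimately show ?thesis by (intro cos_monotone_0_pi) auto
  next
    case False
    moreover have "0 \<le> \<delta>" "\<delta> < 2 * pi - (v - m)"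
      using assms by (simp_all add: m_def \<delta>_def field_simps)
    ultimately have "cos (2 * pi - (v - m)) < cos \<delta>"
      by (intro cos_monotone_0_pi) auto
    then show ?thesis by (simp only: cos_2pi_minus)
  qed
  moreover have "s - m = - \<delta>" "u - m = \<delta>" by (simp_all add: m_def \<delta>_def field_simps)
  ultimately have "inner (- cis m) (P s) = - inner (cis m) z - r * cos \<delta>"
    "inner (- cis m) (P u) = - inner (cis m) z - r * cos \<delta>"
    "inner (- cis m) (P t) < - inner (cis m) z - r * cos \<delta>"
    "- inner (cis m) z - r * cos \<delta> < inner (- cis m) (P v)"
    unfolding inner_P using \<open>0 < r\<close> by simp_all
  then show ?thesis by blast
qed

text \<open>
  The relation \<open>E\<close> has no crossing pair of chords when its vertices are listed along a line (or
  around a circle cut open at a point) in the order of their values under \<open>x\<close>.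
\<close>

definition noncrossing :: "('a \<Rightarrow> real) \<Rightarrow> ('a \<times> 'a) set \<Rightarrow> bool" where
  "noncrossing x E \<longleftrightarrow>
     (\<forall>a b c d. (a, c) \<in> E \<longrightarrow> (b, d) \<in> E \<longrightarrow> \<not> (x a < x b \<and> x b < x c \<and> x c < x d))"

lemma arc_orientation:
  assumes "arc g" "{pathstart g, pathfinish g} = {a, b}"
  obtains h where "arc h" "pathstart h = a" "pathfinish h = b" "path_image h = path_image g"
proof (cases "pathstart g = a")
  case True
  with assms that[of g] arc_distinct_ends[of g] show ?thesis by (auto simp: doubleton_eq_iff)
next
  case False
  with assms that[of "reversepath g"] show ?thesis
    by (auto simp: doubleton_eq_iff arc_reversepath)
qed

text \<open>
  The order is by angle around the circle of the drawing. Two edges whose ends alternate would be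
  disjoint arcs as excluded by \<open>no_crossing_outside_disc\<close>.
\<close>

lemma outerplanar_noncrossing:
  assumes "pair_graph G" "outerplanar G"
  obtains x where "inj_on x (pverts G)" "noncrossing x (parcs G)"
proof -
  interpret pair_graph G by fact
  obtain z r p \<gamma> where draw: "outerplanar_drawing G z r p \<gamma>"
    using assms(2) unfolding outerplanar_def by blast
  note d = draw[unfolded outerplanar_drawing_def]
  have r: "0 < r" using d by blast
  define x where "x v = Arg2pi ((p v - z) / of_real r)" for v
  have p: "p v = z + of_real r * cis (x v)" if "v \<in> pverts G" for v
  proof -
    have "norm (p v - z) = r" using d that by (auto simp: dist_norm norm_minus_commute)
    then have "norm ((p v - z) / of_real r) = 1" using r by (simp add: norm_divide)
    then have "cis (x v) = (p v - z) / of_real r"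
      unfolding x_def cis_conv_exp complex_norm_eq_1_exp .
    with r show ?thesis by simp
  qed
  have inj: "inj_on x (pverts G)"
    using d p unfolding inj_on_def by metis
  have "False" if E: "(a, c) \<in> parcs G" "(b, e) \<in> parcs G"
    and less: "x a < x b" "x b < x c" "x c < x e" for a b c e
  proof -
    have V: "a \<in> pverts G" "c \<in> pverts G" "b \<in> pverts G" "e \<in> pverts G"
      using E in_arcsD1 in_arcsD2 by blast+
    have ed: "{a, c} \<in> edges G" "{b, e} \<in> edges G" using E unfolding edges_def by blast+
    have disj: "{a, c} \<inter> {b, e} = {}" using less by auto
    have bounds: "0 \<le> x a" "x e < 2 * pi" unfolding x_def by (simp_all add: Arg2pi_ge_0 Arg2pi_lt_2pi)
    obtain n k where sides: "inner n (p a) = k" "inner n (p c) = k" "inner n (p b) < k" "k < inner n (p e)"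
      using circle_chord_sides[OF r bounds(1) less bounds(2), of z] p V by auto
    obtain g where g: "Path_Connected.arc g" "pathstart g = p a" "pathfinish g = p c" "path_image g = path_image (\<gamma> {a, c})"
      using arc_orientation[of "\<gamma> {a, c}" "p a" "p c"] d ed by (metis image_insert image_empty)
    obtain h where h: "Path_Connected.arc h" "pathstart h = p b" "pathfinish h = p e" "path_image h = path_image (\<gamma> {b, e})"
      using arc_orientation[of "\<gamma> {b, e}" "p b" "p e"] d ed by (metis image_insert image_empty)
    have *: "path_image g \<inter> ball z r = {}" "path_image h \<inter> ball z r = {}"
      using g(4) h(4) d ed by auto
    have "{a, c} \<noteq> {b, e}" using disj by blast
    then have **: "path_image g \<inter> path_image h = {}"
      using g(4) h(4) d ed disj by (metis image_empty subset_empty)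
    have on: "p a \<in> sphere z r" "p b \<in> sphere z r" "p c \<in> sphere z r" "p e \<in> sphere z r"
      using d V by blast+
    have "p a \<noteq> p c" using inj V d less unfolding inj_on_def by (metis less_trans less_irrefl)
    from no_crossing_outside_disc[OF g(1-3) *(1) h(1-3) *(2) on r this ** sides] show False .
  qed
  then show thesis using that[OF inj] unfolding noncrossing_def by blast
qed

section \<open>Won positions and strategies\<close>

text \<open>
  Capture in one round, in which the cops move from \<open>C\<close> to \<open>C'\<close> and the robot from \<open>r\<close> to \<open>r'\<close>.
\<close>

definition caught :: "nat \<Rightarrow> (nat \<Rightarrow> 'a) \<Rightarrow> (nat \<Rightarrow> 'a) \<Rightarrow> 'a \<Rightarrow> 'a \<Rightarrow> bool" where
  "caught k C C' r r' \<longleftrightarrow> (\<exists>i<k. C' i = r' \<or> r \<noteq> r' \<and> {r, r'} = {C i, C' i})"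

lemma captured_in_round_caught:
  "captured_in_round k C R t \<longleftrightarrow> caught k (C t) (C (Suc t)) (R t) (R (Suc t))"
  unfolding captured_in_round_def caught_def ..

text \<open>
  Backward induction: \<open>wins_in G k n C r\<close> says that \<open>k\<close> cops at \<open>C\<close>, to move against the robot
  at \<open>r\<close>, can force a capture within \<open>n\<close> rounds. Only the values \<open>C i\<close> with \<open>i < k\<close> matter.
\<close>

primrec wins_in :: "'a pair_pre_digraph \<Rightarrow> nat \<Rightarrow> nat \<Rightarrow> (nat \<Rightarrow> 'a) \<Rightarrow> 'a \<Rightarrow> bool" where
  "wins_in G k 0 C r = False"
| "wins_in G k (Suc n) C r =
     (\<exists>C'. (\<forall>i<k. C' i \<in> closed_nbhd G (C i)) \<and>
        (\<forall>r'\<in>closed_nbhd G r. caught k C C' r r' \<or> wins_in G k n C' r'))"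

text \<open>
  A position is won if it is won within some number of rounds.
\<close>

definition cops_win :: "'a pair_pre_digraph \<Rightarrow> nat \<Rightarrow> (nat \<Rightarrow> 'a) \<Rightarrow> 'a \<Rightarrow> bool" where
  "cops_win G k C r \<longleftrightarrow> (\<exists>n. wins_in G k n C r)"

lemma wins_in_mono: "wins_in G k m C r \<Longrightarrow> m \<le> n \<Longrightarrow> wins_in G k n C r"
proof (induction m arbitrary: n C r)
  case (Suc m)
  from Suc.prems(2) obtain n' where "n = Suc n'" "m \<le> n'" by (cases n) auto
  with Suc.prems(1) Suc.IH show ?case by simp blast
qed simp

lemma finite_closed_nbhd:
  assumes "pair_graph G"
  shows "finite (closed_nbhd G v)"
proof -
  interpret pair_graph G by fact
  have "{w. (v, w) \<in> parcs G} \<subseteq> pverts G" using in_arcsD2 by blast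
  then show ?thesis unfolding closed_nbhd_def by (simp add: finite_subset)
qed

text \<open>
  One step of backward induction. The robot has finitely many replies, so a common bound on the
  number of remaining rounds exists.
\<close>

lemma cops_winI:
  assumes "pair_graph G" "\<And>i. i < k \<Longrightarrow> C' i \<in> closed_nbhd G (C i)"
    and "\<And>r'. r' \<in> closed_nbhd G r \<Longrightarrow> caught k C C' r r' \<or> cops_win G k C' r'"
  shows "cops_win G k C r"
proof -
  have "\<exists>n. \<forall>r'\<in>closed_nbhd G r. caught k C C' r r' \<or> wins_in G k n C' r'"
  proof -
    have "\<forall>r'\<in>closed_nbhd G r. \<exists>n. caught k C C' r r' \<or> wins_in G k n C' r'"
      using assms(3) unfolding cops_win_def by blast
    then obtain f where f: "\<forall>r'\<in>closed_nbhd G r. caught k C C' r r' \<or> wins_in G k (f r') C' r'"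
      by metis
    have "f r' \<le> Max (f ` closed_nbhd G r)" if "r' \<in> closed_nbhd G r" for r'
      using that finite_closed_nbhd[OF assms(1)] by simp
    with f wins_in_mono show ?thesis by metis
  qed
  then obtain n where "wins_in G k (Suc n) C r" using assms(2) by auto
  then show ?thesis unfolding cops_win_def ..
qed

text \<open>
  The cops play without memory. In a position won within \<open>Suc n\<close> rounds but not within \<open>n\<close> they
  make a move after which it is won within \<open>n\<close> rounds; so the number of rounds left drops with
  every move, which would not follow if they merely moved to won positions.
\<close>

lemma cops_win_imp_winning_strategy:
  assumes G: "pair_graph G" and C0: "\<And>i. i < k \<Longrightarrow> C0 i \<in> pverts G"
    and win: "\<And>r. r \<in> pverts G \<Longrightarrow> cops_win G k C0 r"
  shows "\<exists>S. winning_strategy G k S"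
proof -
  define good where "good C r C' \<longleftrightarrow> (\<forall>i<k. C' i \<in> closed_nbhd G (C i)) \<and>
     (\<forall>n. wins_in G k (Suc n) C r \<longrightarrow> \<not> wins_in G k n C r \<longrightarrow>
        (\<forall>r'\<in>closed_nbhd G r. caught k C C' r r' \<or> wins_in G k n C' r'))" for C r C'
  have "\<exists>C'. good C r C'" for C r
  proof (cases "cops_win G k C r")
    case True
    define m where "m = (LEAST n. wins_in G k n C r)"
    have m: "wins_in G k m C r" using True unfolding cops_win_def m_def by (rule LeastI_ex)
    then obtain n where n: "m = Suc n" by (cases m) auto
    \<comment> \<open>The minimal bound is the only one at which the position changes from not won to won.\<close>
    have "l = n" if "wins_in G k (Suc l) C r" "\<not> wins_in G k l C r" for l
    proof -
      have "m \<le> Suc l" using that(1) unfolding m_def by (rule Least_le)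
      moreover have "l < m" using m that(2) wins_in_mono by (metis not_less)
      ultimately show ?thesis using n by simp
    qed
    moreover obtain C' where "\<forall>i<k. C' i \<in> closed_nbhd G (C i)"
      "\<forall>r'\<in>closed_nbhd G r. caught k C C' r r' \<or> wins_in G k n C' r'"
      using m unfolding n by auto
    ultimately have "good C r C'" unfolding good_def by metis
    then show ?thesis by blast
  next
    case False
    \<comment> \<open>In a position that is not won, the cops stay put to remain legal.\<close>
    then have "good C r C" unfolding good_def cops_win_def closed_nbhd_def by blast
    then show ?thesis by blast
  qed
  then obtain move where move: "\<And>C r. good C r (move C r)" by metis
  define S where "S h = foldl move C0 h" for h
  have S_Suc: "cop_positions S R (Suc t) = move (cop_positions S R t) (R t)" for R t
    unfolding cop_positions_def S_def by simp
  have S_0: "cop_positions S R 0 = C0" for R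
    unfolding cop_positions_def S_def by simp
  have "legal_strategy G k S"
    using move C0 unfolding legal_strategy_def S_Suc S_0 good_def by blast
  moreover have "\<exists>t. captured_in_round k (cop_positions S R) R t" if R: "robot_play G R" for R
  proof -
    have "\<exists>t'. captured_in_round k (cop_positions S R) R t'"
      if "wins_in G k n (cop_positions S R t) (R t)" for n t
      using that
    proof (induction n arbitrary: t)
      case (Suc n)
      show ?case
      proof (cases "wins_in G k n (cop_positions S R t) (R t)")
        case True
        then show ?thesis by (rule Suc.IH)
      next
        case False
        moreover have "R (Suc t) \<in> closed_nbhd G (R t)" using R unfolding robot_play_def by blast
        ultimately have "caught k (cop_positions S R t) (cop_positions S R (Suc t)) (R t) (R (Suc t))
            \<or> wins_in G k n (cop_positions S R (Suc t)) (R (Suc t))"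
          using move[of "cop_positions S R t" "R t"] Suc.prems unfolding good_def S_Suc by blast
        then show ?thesis using Suc.IH unfolding captured_in_round_caught by blast
      qed
    qed simp
    moreover have "R 0 \<in> pverts G" using R unfolding robot_play_def by blast
    ultimately show ?thesis using win S_0 unfolding cops_win_def by metis
  qed
  ultimately show ?thesis unfolding winning_strategy_def by blast
qed

text \<open>
  A rule that chooses the robot's move from the cops' positions before and after their move and
  from the robot's own position determines, against every cop strategy, a robot play. This is a
  recursion on the history, since the cops' positions depend on all earlier robot positions.
\<close>

lemma robot_response:
  assumes "v \<in> pverts G"
    and "\<And>C C' r. resp C C' r \<in> closed_nbhd G r"
  obtains R where "robot_play G R" "R 0 = v"
    "\<And>t. R (Suc t) = resp (cop_positions S R t) (cop_positions S R (Suc t)) (R t)"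
proof -
  \<comment> \<open>the history up to the current round, which grows by one position at a time\<close>
  define h where "h = rec_nat [v] (\<lambda>t h. h @ [resp (S (butlast h)) (S h) (last h)])"
  define R where "R t = last (h t)" for t
  have h_Suc: "h (Suc t) = h t @ [resp (S (butlast (h t))) (S (h t)) (last (h t))]" for t
    by (simp add: h_def)
  have h: "h t = map R [0..<Suc t]" for t
  proof (induction t)
    case 0
    show ?case by (simp add: R_def h_def)
  next
    case (Suc t)
    have "h (Suc t) = h t @ [R (Suc t)]" by (simp add: R_def h_Suc)
    with Suc show ?case by simp
  qed
  have R_Suc: "R (Suc t) = resp (cop_positions S R t) (cop_positions S R (Suc t)) (R t)" for t
  proof -
    have "R (Suc t) = resp (S (butlast (h t))) (S (h t)) (last (h t))"
      unfolding R_def h_Suc by simp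
    also have "last (h t) = R t" unfolding R_def ..
    also have "butlast (h t) = map R [0..<t]" unfolding h by simp
    finally show ?thesis unfolding cop_positions_def h[symmetric] .
  qed
  moreover have R_0: "R 0 = v" by (simp add: R_def h_def)
  ultimately have "robot_play G R" using assms unfolding robot_play_def by simp
  then show thesis using R_0 R_Suc by (rule that)
qed

text \<open>
  In a subgraph of minimum degree at least 2 the robot stays where he is until the cop steps onto
  his vertex; then he leaves along an edge of the subgraph other than the one that the cop used.
\<close>

lemma robot_evades_one_cop:
  assumes Z: "Z \<subseteq> pverts G" "Z \<noteq> {}"
    and deg: "\<forall>v\<in>Z. \<exists>a\<in>Z. \<exists>b\<in>Z. a \<noteq> b \<and> a \<noteq> v \<and> b \<noteq> v \<and> (v, a) \<in> parcs G \<and> (v, b) \<in> parcs G"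
    and "k \<le> 1"
  shows "\<not> winning_strategy G k S"
proof
  assume win: "winning_strategy G k S"
  define escape where "escape c v = (SOME w. w \<in> Z \<and> w \<noteq> c \<and> w \<noteq> v \<and> (v, w) \<in> parcs G)" for c v
  have escape: "escape c v \<in> Z \<and> escape c v \<noteq> c \<and> escape c v \<noteq> v \<and> (v, escape c v) \<in> parcs G"
    if "v \<in> Z" for c v
  proof -
    have "\<exists>w. w \<in> Z \<and> w \<noteq> c \<and> w \<noteq> v \<and> (v, w) \<in> parcs G" using deg that by blast
    then show ?thesis unfolding escape_def by (rule someI_ex)
  qed
  obtain v where v: "v \<in> Z" "v \<noteq> S [] 0"
    using Z(2) deg by (metis ex_in_conv)
  define resp :: "(nat \<Rightarrow> 'a) \<Rightarrow> (nat \<Rightarrow> 'a) \<Rightarrow> 'a \<Rightarrow> 'a" where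
    "resp C C' v = (if v \<in> Z \<and> C' 0 = v then escape (C 0) v else v)" for C C' v
  have "resp C C' v \<in> closed_nbhd G v" for C C' v
    using escape unfolding resp_def closed_nbhd_def by simp
  moreover have "v \<in> pverts G" using v(1) Z(1) by blast
  ultimately obtain R where R: "robot_play G R" "R 0 = v"
    "\<And>t. R (Suc t) = resp (cop_positions S R t) (cop_positions S R (Suc t)) (R t)"
    using robot_response[of v G resp S] by metis
  have safe: "R t \<in> Z \<and> R t \<noteq> cop_positions S R t 0" for t
  proof (induction t)
    case 0
    show ?case using v R(2) by (simp add: cop_positions_def)
  next
    case (Suc t)
    then show ?case using escape unfolding R(3) resp_def by auto
  qed
  obtain t i where "i < k" and i: "cop_positions S R (Suc t) i = R (Suc t) \<or>
      R t \<noteq> R (Suc t) \<and> {R t, R (Suc t)} = {cop_positions S R t i, cop_positions S R (Suc t) i}"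
    using win R(1) unfolding winning_strategy_def captured_in_round_def by blast
  with \<open>k \<le> 1\<close> have "i = 0" by simp
  with i safe have *: "R t \<noteq> R (Suc t)"
    "{R t, R (Suc t)} = {cop_positions S R t 0, cop_positions S R (Suc t) 0}" by metis+
  then have "R (Suc t) = escape (cop_positions S R t 0) (R t)"
    using R(3) unfolding resp_def by metis
  then have "R (Suc t) \<noteq> cop_positions S R t 0" using escape safe by metis
  with * safe show False by (metis doubleton_eq_iff)
qed

lemma zero_cops_lose:
  assumes "pverts G \<noteq> {}"
  shows "\<not> winning_strategy G 0 S"
proof -
  obtain v where "v \<in> pverts G" using assms by blast
  then have "robot_play G (\<lambda>t. v)" unfolding robot_play_def closed_nbhd_def by simp
  then show ?thesis unfolding winning_strategy_def captured_in_round_def by blast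
qed

lemma c_cr_eqI:
  assumes "winning_strategy G k S" "\<And>j S. j < k \<Longrightarrow> \<not> winning_strategy G j S"
  shows "c_cr G = k"
  unfolding c_cr_def
proof (rule Least_equality)
  show "\<exists>S. winning_strategy G k S" using assms(1) by blast
  fix j assume "\<exists>S. winning_strategy G j S"
  with assms(2) show "k \<le> j" by (metis not_le)
qed

section \<open>Connected graphs and territories\<close>

lemma connected_imp_rtrancl:
  assumes "pair_graph G" "Digraph_Component.connected (with_proj G)"
  shows "pverts G \<noteq> {}" "u \<in> pverts G \<Longrightarrow> v \<in> pverts G \<Longrightarrow> (u, v) \<in> (parcs G)\<^sup>*"
proof -
  interpret pair_graph G by fact
  have "strongly_connected (with_proj G)"
    using symmetric_connected_imp_strongly_connected assms(2) pair_sym_arcs by blast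
  then show "pverts G \<noteq> {}" "u \<in> pverts G \<Longrightarrow> v \<in> pverts G \<Longrightarrow> (u, v) \<in> (parcs G)\<^sup>*"
    unfolding strongly_connected_def reachable_def with_proj_simps
    by (blast, metis rtrancl_on_rtranclI)
qed

lemma finite_has_least:
  fixes f :: "'b \<Rightarrow> real"
  assumes "finite A" "A \<noteq> {}"
  shows "\<exists>a\<in>A. \<forall>b\<in>A. f a \<le> f b"
  using arg_min_if_finite[OF assms, of f] by (metis not_le)

lemma pcas_fst_nth:
  "pcas u p v \<Longrightarrow> j < length p \<Longrightarrow> fst (p ! j) = (if j = 0 then u else snd (p ! (j - 1)))"
  by (induction p arbitrary: u j) (auto simp: nth_Cons split: nat.splits)

lemma pcas_snd_last: "pcas u p v \<Longrightarrow> p \<noteq> [] \<Longrightarrow> snd (last p) = v"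
  by (induction p arbitrary: u) (auto split: if_splits)

text \<open>
  Finite simple graphs whose vertices are mutually reachable; the graph without vertices is included.
\<close>

locale connected_pair_graph = pair_graph +
  assumes reach: "u \<in> pverts G \<Longrightarrow> v \<in> pverts G \<Longrightarrow> (u, v) \<in> (parcs G)\<^sup>*"
begin

text \<open>
  The vertices by which the robot can leave the vertex set \<open>T\<close>. With cops on all of them he stays
  in \<open>T\<close> or is captured.
\<close>

definition boundary :: "'a set \<Rightarrow> 'a set" where
  "boundary T = {w. w \<notin> T \<and> (\<exists>v\<in>T. (v, w) \<in> parcs G)}"

lemma boundary_nonempty:
  assumes "T \<subset> pverts G" "v \<in> T"
  shows "boundary T \<noteq> {}"
proof
  assume *: "boundary T = {}"
  obtain w where w: "w \<in> pverts G" "w \<notin> T" using assms by blast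
  have "(v, w) \<in> (parcs G)\<^sup>*" using reach assms w by blast
  then have "w \<in> T" by induction (use * assms(2) in \<open>auto simp: boundary_def\<close>)
  with w show False by blast
qed

lemma first_nbr:
  fixes x :: "'a \<Rightarrow> real"
  assumes "b \<in> boundary T"
  obtains c where "c \<in> T" "(c, b) \<in> parcs G" "\<And>v. v \<in> T \<Longrightarrow> (v, b) \<in> parcs G \<Longrightarrow> x c \<le> x v"
proof -
  let ?N = "{v \<in> T. (v, b) \<in> parcs G}"
  have "?N \<subseteq> pverts G" using in_arcsD1 by blast
  then have "finite ?N" using pair_finite_verts finite_subset by blast
  moreover have "?N \<noteq> {}" using assms unfolding boundary_def by blast
  ultimately have "\<exists>c\<in>?N. \<forall>v\<in>?N. x c \<le> x v" by (rule finite_has_least)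
  then show thesis using that by blast
qed

lemma robot_confined:
  assumes "r \<in> T" "r' \<in> closed_nbhd G r"
  shows "r' \<in> T \<or> r' \<in> boundary T"
  using assms unfolding closed_nbhd_def boundary_def by blast

section \<open>Trees and cycles\<close>

text \<open>
  The component of \<open>r\<close> in the graph without the vertex \<open>c\<close> (for \<open>r \<noteq> c\<close>).
\<close>

definition reach_avoiding :: "'a \<Rightarrow> 'a \<Rightarrow> 'a set" where
  "reach_avoiding c r = {v. (r, v) \<in> (parcs G \<inter> (- {c}) \<times> (- {c}))\<^sup>*}"

lemma reach_avoiding_refl: "r \<in> reach_avoiding c r"
  unfolding reach_avoiding_def by simp

lemma reach_avoiding_step:
  "v \<in> reach_avoiding c r \<Longrightarrow> (v, w) \<in> parcs G \<Longrightarrow> v \<noteq> c \<Longrightarrow> w \<noteq> c \<Longrightarrow> w \<in> reach_avoiding c r"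
  unfolding reach_avoiding_def by (auto intro: rtrancl_into_rtrancl)

lemma reach_avoiding_subset:
  assumes "r \<in> pverts G" "r \<noteq> c"
  shows "reach_avoiding c r \<subseteq> pverts G - {c}"
proof
  fix v assume "v \<in> reach_avoiding c r"
  then have "(r, v) \<in> (parcs G \<inter> (- {c}) \<times> (- {c}))\<^sup>*" unfolding reach_avoiding_def by simp
  then show "v \<in> pverts G - {c}"
    by induction (use assms in_arcsD2 in auto)
qed

lemma cycle_through_two_nbrs:
  assumes c: "(c, u) \<in> parcs G" "(c, v) \<in> parcs G" "u \<noteq> v"
    and uv: "(u, v) \<in> (parcs G \<inter> (- {c}) \<times> (- {c}))\<^sup>*"
  shows "\<exists>p. cycle p \<and> 3 \<le> length p"
proof -
  have "u \<noteq> c" using c(1) no_loops' by blast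
  have "\<exists>p. awalk u p v \<and> c \<notin> set (awalk_verts u p)"
    using uv
  proof (induction rule: rtrancl_induct)
    case base
    have "awalk u [] u" using c(1) in_arcsD2 by (simp add: awalk_Nil_iff)
    with \<open>u \<noteq> c\<close> show ?case by force
  next
    case (step y z)
    then obtain p where p: "awalk u p y" "c \<notin> set (awalk_verts u p)" by blast
    have yz: "awalk y [(y, z)] z"
      using step.hyps(2) in_arcsD2 by (auto simp: awalk_simps)
    have pz: "awalk u (p @ [(y, z)]) z" using awalk_appendI[OF p(1) yz] .
    moreover have "c \<notin> set (awalk_verts u (p @ [(y, z)]))"
      using p(2) step.hyps(2) set_awalk_verts[OF p(1)] set_awalk_verts[OF pz] by auto
    ultimately show ?case by blast
  qed
  then obtain p where p: "awalk u p v" "c \<notin> set (awalk_verts u p)" by blast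
  define q where "q = awalk_to_apath p"
  have q: "apath u q v" unfolding q_def using p(1) by (rule apath_awalk_to_apath)
  then have qw: "awalk u q v" and qd: "distinct (awalk_verts u q)" unfolding apath_def by auto
  have "set q \<subseteq> set p" unfolding q_def using p(1) by (rule awalk_to_apath_subset)
  then have cq: "c \<notin> set (awalk_verts u q)"
    using p(2) set_awalk_verts[OF p(1)] set_awalk_verts[OF qw] by auto
  have "q \<noteq> []" using qw c(3) by (auto simp: awalk_Nil_iff)
  have vc: "awalk v [(v, c)] c"
    using c(2) arcs_symmetric in_arcsD1 by (auto simp: awalk_simps)
  have q': "awalk u (q @ [(v, c)]) c" using awalk_appendI[OF qw vc] .
  then have "awalk c ((c, u) # q @ [(v, c)]) c"
    using c(1) by (subst awalk_Cons_iff) simp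
  moreover have "distinct (tl (awalk_verts c ((c, u) # q @ [(v, c)])))"
    using qd cq awalk_verts_append[OF q'] qw by auto
  ultimately have "cycle ((c, u) # q @ [(v, c)])" unfolding cycle_def by blast
  moreover have "3 \<le> length ((c, u) # q @ [(v, c)])" using \<open>q \<noteq> []\<close> by (cases q) auto
  ultimately show ?thesis by blast
qed

text \<open>
  A reply \<open>r' = c\<close> of the robot from \<open>r = c'\<close> loses because he crosses the cop's edge.
\<close>

lemma cops_win_oneI:
  assumes "c' \<in> closed_nbhd G c"
    and "\<And>r'. r' \<in> closed_nbhd G r \<Longrightarrow> r' \<noteq> c' \<Longrightarrow> \<not> (r = c' \<and> r' = c) \<Longrightarrow> cops_win G 1 (\<lambda>_. c') r'"
  shows "cops_win G 1 (\<lambda>_. c) r"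
  using pair_graph
proof (rule cops_winI)
  show "\<And>i. i < 1 \<Longrightarrow> c' \<in> closed_nbhd G c" using assms(1) .
  fix r' assume "r' \<in> closed_nbhd G r"
  with assms(2) show "caught 1 (\<lambda>_. c) (\<lambda>_. c') r r' \<or> cops_win G 1 (\<lambda>_. c') r'"
    unfolding caught_def by (cases "r = r'") (auto simp: insert_commute)
qed

text \<open>
  The cop at \<open>c\<close> has exactly one neighbour \<open>c'\<close> in the robot's component of \<open>G - c\<close>, and moves there.
  The robot cannot slip past to \<open>c\<close>: he would have to come from \<open>c'\<close>, along the cop's edge. So his new
  component, in \<open>G - c'\<close>, is strictly smaller.
\<close>

lemma one_cop_wins_tree_aux:
  assumes acyclic: "\<not> (\<exists>p. cycle p \<and> 3 \<le> length p)"
    and "c \<in> pverts G" "r \<in> pverts G" "c \<noteq> r"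
  shows "cops_win G 1 (\<lambda>_. c) r"
  using assms(2-)
proof (induction "card (reach_avoiding c r)" arbitrary: c r rule: less_induct)
  case less
  define T where "T = reach_avoiding c r"
  have T: "T \<subseteq> pverts G - {c}" "r \<in> T"
    using reach_avoiding_subset reach_avoiding_refl less.prems unfolding T_def by auto
  have T_step: "w \<in> T" if "v \<in> T" "(v, w) \<in> parcs G" "w \<noteq> c" for v w
    using that reach_avoiding_step T(1) unfolding T_def by blast
  have "boundary T \<noteq> {}" using boundary_nonempty T less.prems by blast
  then obtain c' where c': "c' \<in> T" "(c', c) \<in> parcs G" using T_step unfolding boundary_def by blast
  have unique: "v = c'" if "v \<in> T" "(v, c) \<in> parcs G" for v
  proof (rule ccontr)
    assume "v \<noteq> c'"
    let ?E = "parcs G \<inter> (- {c}) \<times> (- {c})"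
    have "sym ?E" by (auto simp: sym_def intro: arcs_symmetric)
    have "(r, v) \<in> ?E\<^sup>*" "(r, c') \<in> ?E\<^sup>*"
      using that c' unfolding T_def reach_avoiding_def by auto
    then have "(v, c') \<in> ?E\<^sup>*"
      using sym_rtrancl[OF \<open>sym ?E\<close>] by (meson rtrancl_trans symD)
    with acyclic cycle_through_two_nbrs[of c v c'] that c' \<open>v \<noteq> c'\<close> arcs_symmetric
    show False by blast
  qed
  show ?case
  proof (rule cops_win_oneI)
    show "c' \<in> closed_nbhd G c" using c' arcs_symmetric unfolding closed_nbhd_def by blast
    fix r' assume r': "r' \<in> closed_nbhd G r" "r' \<noteq> c'" "\<not> (r = c' \<and> r' = c)"
    have "r' \<in> T"
    proof (cases "r' = c")
      case True
      then have "(r, c) \<in> parcs G" using r'(1) T unfolding closed_nbhd_def by auto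
      with unique T(2) r'(3) True show ?thesis by blast
    next
      case False
      then show ?thesis using r'(1) T_step T(2) unfolding closed_nbhd_def by blast
    qed
    have "v \<in> T" if "v \<in> reach_avoiding c' r'" for v
    proof -
      from that have "(r', v) \<in> (parcs G \<inter> (- {c'}) \<times> (- {c'}))\<^sup>*" unfolding reach_avoiding_def by simp
      then show ?thesis
      proof induction
        case (step y z)
        then have "z \<noteq> c" using unique by blast
        with step T_step show ?case by blast
      qed (fact \<open>r' \<in> T\<close>)
    qed
    moreover have r'V: "r' \<in> pverts G" and c'V: "c' \<in> pverts G" using \<open>r' \<in> T\<close> c'(1) T(1) by auto
    moreover have "c' \<notin> reach_avoiding c' r'"
      using reach_avoiding_subset[OF r'V r'(2)] by blast
    ultimately have "reach_avoiding c' r' \<subset> T" using c'(1) by blast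
    moreover have "finite T" using T(1) pair_finite_verts finite_subset by blast
    ultimately have "card (reach_avoiding c' r') < card (reach_avoiding c r)"
      unfolding T_def by (rule psubset_card_mono[rotated])
    then show "cops_win G 1 (\<lambda>_. c') r'"
      using less.hyps r'V c'V r'(2) by blast
  qed
qed

lemma one_cop_wins_tree:
  assumes acyclic: "\<not> (\<exists>p. cycle p \<and> 3 \<le> length p)"
    and "c \<in> pverts G" "r \<in> pverts G"
  shows "cops_win G 1 (\<lambda>_. c) r"
proof (cases "c = r")
  case True
  show ?thesis
  proof (rule cops_win_oneI)
    show "c \<in> closed_nbhd G c" unfolding closed_nbhd_def by simp
    fix r' assume "r' \<in> closed_nbhd G r" "r' \<noteq> c"
    moreover have "r' \<in> pverts G" using calculation assms(3) in_arcsD2 unfolding closed_nbhd_def by blast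
    ultimately show "cops_win G 1 (\<lambda>_. c) r'" using one_cop_wins_tree_aux assms by blast
  qed
next
  case False
  then show ?thesis using one_cop_wins_tree_aux assms by blast
qed

text \<open>
  Here \<open>Z\<close> is the vertex set of the cycle. Length at least 3 makes successor and predecessor differ.
\<close>

lemma cycle_nbrs:
  assumes "cycle p" "3 \<le> length p"
  obtains Z where "Z \<subseteq> pverts G" "Z \<noteq> {}"
    "\<forall>v\<in>Z. \<exists>a\<in>Z. \<exists>b\<in>Z. a \<noteq> b \<and> a \<noteq> v \<and> b \<noteq> v \<and> (v, a) \<in> parcs G \<and> (v, b) \<in> parcs G"
proof -
  obtain u where u: "awalk u p u" "distinct (tl (awalk_verts u p))"
    using assms(1) unfolding cycle_def by blast
  define n where "n = length p"
  have n: "3 \<le> n" using assms(2) unfolding n_def .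
  then have "p \<noteq> []" unfolding n_def by auto
  have cas: "pcas u p u" and arcs: "set p \<subseteq> parcs G" using u(1) unfolding awalk_def by auto
  define w where "w i = snd (p ! i)" for i
  have "tl (awalk_verts u p) = map snd p"
    using awalk_verts_conv'[OF cas] \<open>p \<noteq> []\<close> by simp
  then have inj: "i = j" if "w i = w j" "i < n" "j < n" for i j
    using u(2) that nth_eq_iff_index_eq[of "map snd p" i j] unfolding w_def n_def by simp
  have succ: "(w i, w (Suc i mod n)) \<in> parcs G" if "i < n" for i
  proof -
    have "fst (p ! (Suc i mod n)) = w i"
    proof (cases "Suc i = n")
      case True
      then have "last p = p ! i" using \<open>p \<noteq> []\<close> unfolding n_def by (metis diff_Suc_1 last_conv_nth)
      with True show ?thesis
        using pcas_fst_nth[OF cas, of 0] pcas_snd_last[OF cas \<open>p \<noteq> []\<close>] \<open>p \<noteq> []\<close>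
        by (simp add: w_def)
    next
      case False
      with \<open>i < n\<close> have "Suc i < n" by simp
      then show ?thesis using pcas_fst_nth[OF cas, of "Suc i"] unfolding n_def w_def by simp
    qed
    moreover have "p ! (Suc i mod n) \<in> parcs G"
      using \<open>p \<noteq> []\<close> unfolding n_def by (intro subsetD[OF arcs] nth_mem mod_less_divisor) simp
    ultimately show ?thesis unfolding w_def by (metis prod.collapse)
  qed
  show thesis
  proof (rule that[of "w ` {..<n}"])
    show "w ` {..<n} \<subseteq> pverts G" using succ in_arcsD1 by blast
    show "w ` {..<n} \<noteq> {}" using n by (simp add: lessThan_empty_iff)
    show "\<forall>v\<in>w ` {..<n}. \<exists>a\<in>w ` {..<n}. \<exists>b\<in>w ` {..<n}. a \<noteq> b \<and> a \<noteq> v \<and> b \<noteq> v \<and>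
        (v, a) \<in> parcs G \<and> (v, b) \<in> parcs G"
    proof
      fix v assume "v \<in> w ` {..<n}"
      then obtain i where i: "i < n" "v = w i" by blast
      define j where "j = (if i = 0 then n - 1 else i - 1)"
      define k where "k = Suc i mod n"
      have k: "k = (if Suc i = n then 0 else Suc i)" using i(1) unfolding k_def by simp
      have less: "j < n" "k < n" using n i(1) unfolding j_def k by auto
      have "Suc j mod n = i" using n i(1) unfolding j_def by auto
      then have "(w i, w j) \<in> parcs G" using succ[OF less(1)] arcs_symmetric by simp
      moreover have "(w i, w k) \<in> parcs G" using succ[OF i(1)] unfolding k_def .
      moreover have "j \<noteq> k" "j \<noteq> i" "k \<noteq> i" using n i(1) unfolding j_def k by auto
      then have "w j \<noteq> w k" "w j \<noteq> w i" "w k \<noteq> w i" using inj less i(1) by blast+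
      ultimately show "\<exists>a\<in>w ` {..<n}. \<exists>b\<in>w ` {..<n}. a \<noteq> b \<and> a \<noteq> v \<and> b \<noteq> v \<and>
          (v, a) \<in> parcs G \<and> (v, b) \<in> parcs G"
        using less i(2) by (intro bexI[of _ "w j"] bexI[of _ "w k"]) auto
    qed
  qed
qed

section \<open>Two cops win on outerplanar graphs\<close>

text \<open>
  Two cops on \<open>a\<close> and \<open>b\<close>, to move, win against the robot on \<open>r\<close>.
\<close>

abbreviation win2 :: "'a \<Rightarrow> 'a \<Rightarrow> 'a \<Rightarrow> bool" where
  "win2 a b r \<equiv> cops_win G 2 (\<lambda>i. if i = 0 then a else b) r"

lemma caught_two:
  "caught 2 (\<lambda>i. if i = 0 then a else b) (\<lambda>i. if i = 0 then a' else b') r r' \<longleftrightarrow>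
     a' = r' \<or> b' = r' \<or> r \<noteq> r' \<and> ({r, r'} = {a, a'} \<or> {r, r'} = {b, b'})"
  unfolding caught_def by (auto simp: less_2_cases_iff)

lemma win2I:
  assumes "a' \<in> closed_nbhd G a" "b' \<in> closed_nbhd G b"
    and "\<And>r'. r' \<in> closed_nbhd G r \<Longrightarrow> r' \<noteq> a' \<Longrightarrow> r' \<noteq> b' \<Longrightarrow> \<not> (r = a' \<and> r' = a)
           \<Longrightarrow> \<not> (r = b' \<and> r' = b) \<Longrightarrow> win2 a' b' r'"
  shows "win2 a b r"
  using pair_graph
proof (rule cops_winI)
  show "\<And>i. i < 2 \<Longrightarrow> (if i = 0 then a' else b') \<in> closed_nbhd G (if i = 0 then a else b)"
    using assms(1,2) by simp
  fix r' assume r': "r' \<in> closed_nbhd G r"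
  show "caught 2 (\<lambda>i. if i = 0 then a else b) (\<lambda>i. if i = 0 then a' else b') r r' \<or> win2 a' b' r'"
  proof (cases "r' = a' \<or> r' = b' \<or> r = a' \<and> r' = a \<or> r = b' \<and> r' = b")
    case True
    then have "caught 2 (\<lambda>i. if i = 0 then a else b) (\<lambda>i. if i = 0 then a' else b') r r'"
      unfolding caught_two by auto
    then show ?thesis ..
  next
    case False
    with assms(3) r' show ?thesis by blast
  qed
qed

lemma wins_in_swap:
  "wins_in G 2 n C r \<Longrightarrow> wins_in G 2 n (\<lambda>i. C (1 - i)) r"
proof (induction n arbitrary: C r)
  case (Suc n)
  then obtain C' where C': "\<forall>i<2. C' i \<in> closed_nbhd G (C i)"
    "\<forall>r'\<in>closed_nbhd G r. caught 2 C C' r r' \<or> wins_in G 2 n C' r'" by auto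
  have "\<forall>i<2. C' (1 - i) \<in> closed_nbhd G (C (1 - i))" using C'(1) by simp
  moreover have "caught 2 (\<lambda>i. C (1 - i)) (\<lambda>i. C' (1 - i)) r r'" if "caught 2 C C' r r'" for r'
  proof -
    obtain i where "i < 2" "C' i = r' \<or> r \<noteq> r' \<and> {r, r'} = {C i, C' i}"
      using \<open>caught 2 C C' r r'\<close> unfolding caught_def by blast
    moreover then have "1 - i < 2" "1 - (1 - i) = i" by auto
    ultimately show ?thesis unfolding caught_def by metis
  qed
  ultimately show ?case
    unfolding wins_in.simps using C'(2) Suc.IH by (intro exI[of _ "\<lambda>i. C' (1 - i)"]) blast
qed simp

lemma win2_swap: "win2 a b r \<Longrightarrow> win2 b a r"
proof -
  assume "win2 a b r"
  then have "cops_win G 2 (\<lambda>i. if 1 - i = 0 then a else b) r"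
    unfolding cops_win_def using wins_in_swap by blast
  moreover have "(\<lambda>i. if 1 - i = 0 then a else b) = (\<lambda>i::nat. if i = 0 then b else a)"
    by auto
  ultimately show ?thesis by simp
qed

text \<open>
  If a single cop holds the boundary of the robot's territory, the other one is free to walk.
\<close>

lemma win2_walk:
  assumes "boundary T \<subseteq> {b}" "a \<in> pverts G" "a' \<in> pverts G"
    and win: "\<And>r. r \<in> T \<Longrightarrow> win2 a' b r"
    and "r \<in> T"
  shows "win2 a b r"
proof -
  have "(a, a') \<in> (parcs G)\<^sup>*" using reach assms(2,3) .
  then show ?thesis using \<open>r \<in> T\<close>
  proof (induction arbitrary: r rule: converse_rtrancl_induct)
    case base
    then show ?case by (rule win)
  next
    case (step y z)
    show ?case
    proof (rule win2I)
      show "z \<in> closed_nbhd G y" using step.hyps unfolding closed_nbhd_def by simp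
      show "b \<in> closed_nbhd G b" unfolding closed_nbhd_def by simp
      fix r' assume "r' \<in> closed_nbhd G r" "r' \<noteq> b"
      then have "r' \<in> T" using robot_confined[OF step.prems] assms(1) by blast
      then show "win2 z b r'" by (rule step.IH)
    qed
  qed
qed

text \<open>
  Moving the cops onto the boundary of \<open>T\<close> confines the robot to \<open>T\<close>.
\<close>

lemma win2_guard:
  assumes "a' \<in> closed_nbhd G a" "b' \<in> closed_nbhd G b"
    and "r \<in> T" "boundary T \<subseteq> {a', b'}" "\<And>r. r \<in> T \<Longrightarrow> win2 a' b' r"
  shows "win2 a b r"
  using assms(1,2)
proof (rule win2I)
  fix r' assume "r' \<in> closed_nbhd G r" "r' \<noteq> a'" "r' \<noteq> b'"
  then have "r' \<in> T" using robot_confined[OF assms(3)] assms(4) by blast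
  then show "win2 a' b' r'" by (rule assms(5))
qed

text \<open>
  The robot's territory is an open interval of the linear order given by \<open>x\<close>. Its endpoints are
  real numbers, because an endpoint need not belong to a vertex.
\<close>

definition between :: "('a \<Rightarrow> real) \<Rightarrow> real \<Rightarrow> real \<Rightarrow> 'a set" where
  "between x l u = {v \<in> pverts G. l < x v \<and> x v < u}"

text \<open>
  The interval can be left only by its endpoints.
\<close>

definition territory :: "('a \<Rightarrow> real) \<Rightarrow> real \<Rightarrow> real \<Rightarrow> bool" where
  "territory x l u \<longleftrightarrow> (\<forall>w\<in>boundary (between x l u). x w = l \<or> x w = u)"

text \<open>
  Two cops win whenever they hold the boundary of the interval \<open>T\<close> and the robot is in \<open>T\<close>.
  The cop that is not needed on the boundary may be anywhere.
\<close>

definition clearable :: "('a \<Rightarrow> real) \<Rightarrow> 'a set \<Rightarrow> bool" where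
  "clearable x T \<longleftrightarrow> (\<forall>l u a b r. T = between x l u \<longrightarrow> territory x l u \<longrightarrow>
     boundary T \<subseteq> {a, b} \<longrightarrow> a \<in> pverts G \<longrightarrow> b \<in> pverts G \<longrightarrow> r \<in> T \<longrightarrow> win2 a b r)"

lemma clearableD:
  assumes "clearable x (between x l u)" "territory x l u" "boundary (between x l u) \<subseteq> {a, b}"
    "a \<in> pverts G" "b \<in> pverts G" "r \<in> between x l u"
  shows "win2 a b r"
  using assms unfolding clearable_def by blast

text \<open>
  Reversing the order exchanges the two ends of an interval; the arguments below are given
  for the upper end and transferred to the lower end.
\<close>

lemma between_uminus: "between (\<lambda>v. - x v) (- u) (- l) = between x l u"
  unfolding between_def by auto

lemma territory_uminus: "territory (\<lambda>v. - x v) (- u) (- l) \<longleftrightarrow> territory x l u"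
  unfolding territory_def between_uminus by auto

lemma clearable_uminus_imp:
  assumes "clearable x T"
  shows "clearable (\<lambda>v. - x v) T"
  unfolding clearable_def
proof (intro allI impI)
  fix l u a b r
  assume "T = between (\<lambda>v. - x v) l u" "territory (\<lambda>v. - x v) l u" and *: "boundary T \<subseteq> {a, b}"
    "a \<in> pverts G" "b \<in> pverts G" "r \<in> T"
  then have "T = between x (- u) (- l)" "territory x (- u) (- l)"
    using between_uminus[of x "-l" "-u"] territory_uminus[of x "-l" "-u"] by simp_all
  with * assms show "win2 a b r" unfolding clearable_def by blast
qed

lemma noncrossing_uminus:
  assumes "noncrossing x (parcs G)"
  shows "noncrossing (\<lambda>v. - x v) (parcs G)"
  using assms arcs_symmetric unfolding noncrossing_def by (smt (verit))

text \<open>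
  Suppose that the upper end of an interval is a vertex \<open>b\<close> with a neighbour \<open>c\<close> inside. No edge
  crosses the chord from \<open>c\<close> to \<open>b\<close>, so the part above \<open>c\<close> is again a territory, with boundary
  in \<open>{c, b}\<close>. If \<open>c\<close> is the lowest neighbour of \<open>b\<close> inside, then the part below \<open>c\<close> is a
  territory too, and \<open>b\<close> is not on its boundary.
\<close>

context
  fixes x :: "'a \<Rightarrow> real" and l u :: real and b c :: 'a
  assumes inj: "inj_on x (pverts G)" and nc: "noncrossing x (parcs G)"
    and terr: "territory x l u"
    and b: "b \<in> pverts G" "x b = u"
    and c: "c \<in> between x l u" "(c, b) \<in> parcs G"
begin

lemma left_of_chord:
  assumes "v \<in> between x l (x c)" "(v, w) \<in> parcs G" "w \<notin> between x l (x c)"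
  shows "x w = l \<or> w = c \<or> w = b"
proof -
  have v: "v \<in> between x l u" "x v < x c" using assms(1) c(1) unfolding between_def by auto
  have w: "w \<in> pverts G" using assms(2) in_arcsD2 by blast
  consider "x w = l" | "x w = u" | "w \<in> between x l u"
    using v(1) assms(2) terr unfolding territory_def boundary_def by blast
  then show ?thesis
  proof cases
    case 2
    then show ?thesis using inj b w by (auto simp: inj_on_def)
  next
    case 3
    then have "x c \<le> x w" "x w < x b" using assms(3) b(2) unfolding between_def by auto
    moreover have "\<not> (x v < x c \<and> x c < x w \<and> x w < x b)"
      using nc assms(2) c(2) unfolding noncrossing_def by blast
    ultimately have "x w = x c" using v by simp
    then show ?thesis using inj c(1) w unfolding between_def inj_on_def by blast
  qed simp
qed

lemma right_of_chord:
  assumes "v \<in> between x (x c) u" "(v, w) \<in> parcs G" "w \<notin> between x (x c) u"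
  shows "w = c \<or> w = b"
proof -
  have v: "v \<in> between x l u" "x c < x v" "x v < x b" using assms(1) c(1) b(2) unfolding between_def by auto
  have w: "w \<in> pverts G" using assms(2) in_arcsD2 by blast
  have *: "\<not> (x w < x c \<and> x c < x v \<and> x v < x b)"
    using nc arcs_symmetric[OF assms(2)] c(2) unfolding noncrossing_def by blast
  consider "x w = l" | "x w = u" | "w \<in> between x l u"
    using v(1) assms(2) terr unfolding territory_def boundary_def by blast
  then show ?thesis
  proof cases
    case 1
    with * v c(1) show ?thesis unfolding between_def by auto
  next
    case 2
    then show ?thesis using inj b w by (auto simp: inj_on_def)
  next
    case 3
    then have "x w \<le> x c" using assms(3) unfolding between_def by auto
    with * v have "x w = x c" by simp
    then show ?thesis using inj c(1) w unfolding between_def inj_on_def by blast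
  qed
qed

lemma right_territory: "territory x (x c) u" "boundary (between x (x c) u) \<subseteq> {c, b}"
  using right_of_chord b(2) unfolding territory_def boundary_def by blast+

lemma right_smaller: "between x (x c) u \<subset> between x l u"
  using c(1) unfolding between_def by auto

lemma left_smaller: "between x l (x c) \<subset> between x l u"
  using c(1) unfolding between_def by auto

lemma left_territory:
  assumes "\<And>v. v \<in> between x l u \<Longrightarrow> (v, b) \<in> parcs G \<Longrightarrow> x c \<le> x v"
  shows "territory x l (x c)" "boundary (between x l (x c)) \<subseteq> insert c (boundary (between x l u) - {b})"
proof -
  have *: "x w = l \<or> w = c" "w \<noteq> b"
    if v: "v \<in> between x l (x c)" "(v, w) \<in> parcs G" "w \<notin> between x l (x c)" for v w
  proof -
    have "v \<in> between x l u" "x v < x c" using v(1) c(1) unfolding between_def by auto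
    with assms v(2) show "w \<noteq> b" by force
    with left_of_chord[OF v] show "x w = l \<or> w = c" by blast
  qed
  then show "territory x l (x c)" unfolding territory_def boundary_def by blast
  show "boundary (between x l (x c)) \<subseteq> insert c (boundary (between x l u) - {b})"
  proof
    fix w assume "w \<in> boundary (between x l (x c))"
    then obtain v where v: "v \<in> between x l (x c)" "(v, w) \<in> parcs G" "w \<notin> between x l (x c)"
      unfolding boundary_def by blast
    have "w \<notin> between x l u" if "x w = l" using that unfolding between_def by simp
    moreover have "v \<in> between x l u" using v(1) left_smaller by blast
    ultimately show "w \<in> insert c (boundary (between x l u) - {b})"
      using *[OF v] v(2) unfolding boundary_def by blast
  qed
qed

end

text \<open>
  The robot is below the lowest neighbour \<open>c\<close> of the guard \<open>b\<close>: that guard advances to \<open>c\<close>.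
\<close>

lemma step_left:
  assumes inj: "inj_on x (pverts G)" and nc: "noncrossing x (parcs G)"
    and terr: "territory x l u" and T: "boundary (between x l u) \<subseteq> {a, b}"
    and ab: "a \<in> pverts G" "b \<in> pverts G" "x b = u"
    and c: "c \<in> between x l u" "(c, b) \<in> parcs G"
      "\<And>v. v \<in> between x l u \<Longrightarrow> (v, b) \<in> parcs G \<Longrightarrow> x c \<le> x v"
    and IH: "\<And>T. T \<subset> between x l u \<Longrightarrow> clearable x T"
    and r: "r \<in> between x l u" "x r < x c"
  shows "win2 a b r"
proof (rule win2_guard)
  note L = left_territory[OF inj nc terr ab(2,3) c]
  have bd: "boundary (between x l (x c)) \<subseteq> {a, c}" using L(2) T by blast
  then show "boundary (between x l (x c)) \<subseteq> {a, c}" .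
  show "a \<in> closed_nbhd G a" "c \<in> closed_nbhd G b"
    using c(2) arcs_symmetric unfolding closed_nbhd_def by auto
  show "r \<in> between x l (x c)" using r unfolding between_def by auto
  have cV: "c \<in> pverts G" using c(1) unfolding between_def by simp
  have "clearable x (between x l (x c))"
    using IH left_smaller[OF inj nc terr ab(2,3) c(1,2)] .
  then show "win2 a c r'" if "r' \<in> between x l (x c)" for r'
    using clearableD L(1) bd ab(1) cV that by blast
qed

text \<open>
  The guard \<open>b\<close> is alone on the boundary. The other cop first joins it at \<open>b\<close>. If the robot is then
  above the lowest neighbour \<open>c\<close> of \<open>b\<close>, one cop moves to \<open>c\<close>. If he is on \<open>c\<close>, both cops move there
  and drive him to one side; when that is the upper side, one of them returns to \<open>b\<close>.
\<close>

lemma step_one_guard: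
  assumes inj: "inj_on x (pverts G)" and nc: "noncrossing x (parcs G)"
    and terr: "territory x l u" and T: "boundary (between x l u) = {b}"
    and ab: "a \<in> pverts G" "b \<in> pverts G" "x b = u"
    and IH: "\<And>T. T \<subset> between x l u \<Longrightarrow> clearable x T"
    and r: "r \<in> between x l u"
  shows "win2 a b r"
proof -
  obtain c where c: "c \<in> between x l u" "(c, b) \<in> parcs G"
    "\<And>v. v \<in> between x l u \<Longrightarrow> (v, b) \<in> parcs G \<Longrightarrow> x c \<le> x v"
    using first_nbr[of b "between x l u" x] T by auto
  note R = right_territory[OF inj nc terr ab(2,3) c(1,2)]
  note L = left_territory[OF inj nc terr ab(2,3) c]
  have Lb: "boundary (between x l (x c)) \<subseteq> {c}" using L(2) T by blast
  have cV: "c \<in> pverts G" using c(1) unfolding between_def by simp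
  have nbhd: "c \<in> closed_nbhd G b" "b \<in> closed_nbhd G c" "b \<in> closed_nbhd G b"
    using c(2) arcs_symmetric unfolding closed_nbhd_def by auto
  have winR: "win2 c b r'" if "r' \<in> between x (x c) u" for r'
    using clearableD[OF IH[OF right_smaller[OF inj nc terr ab(2,3) c(1,2)]] R cV ab(2) that] .
  have winL: "win2 c c r'" if "r' \<in> between x l (x c)" for r'
    using clearableD[OF IH[OF left_smaller[OF inj nc terr ab(2,3) c(1,2)]] L(1) _ cV cV that] Lb by simp
  have "win2 b b r" if "r \<in> between x l u" for r
  proof -
    have "r \<in> pverts G" using that unfolding between_def by simp
    then consider "x r < x c" | "x c < x r" | "r = c"
      using inj_onD[OF inj _ _ cV] by fastforce
    then show ?thesis
    proof cases
      case 1
      show ?thesis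
        by (rule step_left[OF inj nc terr _ ab(2) ab(2,3) c IH that 1]) (use T in auto)
    next
      case 2
      then have "r \<in> between x (x c) u" using that unfolding between_def by simp
      then show ?thesis using win2_guard[OF nbhd(1,3) _ R(2) winR] by blast
    next
      case 3
      show ?thesis
      proof (rule win2I[OF nbhd(1) nbhd(1)])
        fix r' assume r': "r' \<in> closed_nbhd G r" "r' \<noteq> c" "\<not> (r = c \<and> r' = b)"
        then have "r' \<in> between x l u" using robot_confined[OF that] T 3 by blast
        moreover from this have "x r' \<noteq> x c" using inj r'(2) cV unfolding between_def inj_on_def by blast
        ultimately consider "r' \<in> between x l (x c)" | "r' \<in> between x (x c) u"
          unfolding between_def by force
        then show "win2 c c r'"
        proof cases
          case 1
          then show ?thesis by (rule winL)
        next
          case 2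
          have "c \<in> closed_nbhd G c" unfolding closed_nbhd_def by simp
          then show ?thesis using win2_guard[OF _ nbhd(2) 2 R(2) winR] by blast
        qed
      qed
    qed
  qed
  then show ?thesis using win2_walk[OF equalityD1[OF T] ab(1,2)] r by blast
qed

text \<open>
  Both ends \<open>a\<close> and \<open>b\<close> are guarded. Let \<open>p\<close> be the highest inner neighbour of \<open>a\<close> and \<open>q\<close> the
  lowest inner neighbour of \<open>b\<close>. A robot below \<open>q\<close> or above \<open>p\<close> lets one guard advance. Otherwise
  \<open>q \<le> r \<le> p\<close>, and since the edges from \<open>a\<close> to \<open>p\<close> and from \<open>q\<close> to \<open>b\<close> do not cross, \<open>p = q = r\<close>:
  both cops move onto the robot, who can use neither of their edges and is driven to one side.
  The cop from that side returns to its end while the other one stays on \<open>r\<close>.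
\<close>

lemma step_two_guards:
  assumes inj: "inj_on x (pverts G)" and nc: "noncrossing x (parcs G)"
    and terr: "territory x l u" and T: "boundary (between x l u) = {a, b}"
    and ab: "a \<in> pverts G" "b \<in> pverts G" "x a = l" "x b = u"
    and IH: "\<And>T. T \<subset> between x l u \<Longrightarrow> clearable x T"
    and r: "r \<in> between x l u"
  shows "win2 a b r"
proof -
  let ?T = "between x l u" and ?y = "\<lambda>v. - x v"
  obtain q where q: "q \<in> ?T" "(q, b) \<in> parcs G"
    "\<And>v. v \<in> ?T \<Longrightarrow> (v, b) \<in> parcs G \<Longrightarrow> x q \<le> x v"
    using first_nbr[of b ?T x] T by auto
  obtain p where p: "p \<in> ?T" "(p, a) \<in> parcs G"
    "\<And>v. v \<in> ?T \<Longrightarrow> (v, a) \<in> parcs G \<Longrightarrow> ?y p \<le> ?y v"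
    using first_nbr[of a ?T ?y] T by auto
  have inj': "inj_on ?y (pverts G)" using inj by (simp add: inj_on_def)
  note nc' = noncrossing_uminus[OF nc]
  have terr': "territory ?y (- u) (- l)" using terr by (simp only: territory_uminus)
  have ya: "?y a = - l" using ab(3) by simp
  have IH': "clearable ?y T" if "T \<subset> ?T" for T using clearable_uminus_imp IH[OF that] .
  consider "x r < x q" | "x p < x r" | "x q \<le> x r" "x r \<le> x p" by linarith
  then show ?thesis
  proof cases
    case 1
    show ?thesis
      by (rule step_left[OF inj nc terr _ ab(1,2,4) q IH r 1]) (simp_all add: T)
  next
    case 2
    have "win2 b a r"
      by (rule step_left[OF inj' nc' terr' _ ab(2,1) ya, of p r, unfolded between_uminus])
        (use T p IH' r 2 in auto)
    then show ?thesis by (rule win2_swap)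
  next
    case 3
    have pqV: "p \<in> pverts G" "q \<in> pverts G" "r \<in> pverts G"
      using p(1) q(1) r unfolding between_def by auto
    have "x a < x q" "x p < x b" using p(1) q(1) ab(3,4) unfolding between_def by auto
    moreover have "\<not> (x a < x q \<and> x q < x p \<and> x p < x b)"
      using nc arcs_symmetric[OF p(2)] q(2) unfolding noncrossing_def by blast
    ultimately have "x p = x r" "x q = x r" using 3 by auto
    then have eq: "p = r" "q = r" using inj pqV unfolding inj_on_def by auto
    have yp: "p \<in> between ?y (- u) (- l)" using p(1) by (simp only: between_uminus)
    note R = right_territory[OF inj nc terr ab(2,4) q(1,2), unfolded eq]
    note L = right_territory[OF inj' nc' terr' ab(1) ya yp p(2),
        unfolded eq between_uminus territory_uminus]
    have winR: "win2 r b r'" if "r' \<in> between x (x r) u" for r'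
      using right_smaller[OF inj nc terr ab(2,4) q(1,2)] eq
      by (intro clearableD[OF IH R pqV(3) ab(2) that]) simp
    have winL: "win2 r a r'" if "r' \<in> between x l (x r)" for r'
      using left_smaller[OF inj nc terr ab(2,4) q(1,2)] eq
      by (intro clearableD[OF IH L pqV(3) ab(1) that]) simp
    have nbhd: "r \<in> closed_nbhd G a" "r \<in> closed_nbhd G b" "a \<in> closed_nbhd G r"
       "b \<in> closed_nbhd G r" "r \<in> closed_nbhd G r"
      using p(2) q(2) eq arcs_symmetric unfolding closed_nbhd_def by auto
    show ?thesis
    proof (rule win2I[OF nbhd(1,2)])
      fix r' assume r': "r' \<in> closed_nbhd G r" "r' \<noteq> r" "\<not> (r = r \<and> r' = a)" "\<not> (r = r \<and> r' = b)"
      then have "r' \<in> ?T" using robot_confined[OF r] T by blast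
      moreover from this have "x r' \<noteq> x r"
        using inj r'(2) pqV(3) unfolding between_def inj_on_def by blast
      ultimately consider "r' \<in> between x l (x r)" | "r' \<in> between x (x r) u"
        unfolding between_def by force
      then show "win2 r r r'"
      proof cases
        case 1
        then show ?thesis using win2_guard[OF nbhd(5,3) 1 L(2) winL] by blast
      next
        case 2
        then show ?thesis using win2_guard[OF nbhd(5,4) 2 R(2) winR] by blast
      qed
    qed
  qed
qed

lemma clearable_territory:
  assumes inj: "inj_on x (pverts G)" and nc: "noncrossing x (parcs G)"
    and "T \<subset> pverts G"
  shows "clearable x T"
proof -
  have "finite T" using assms(3) pair_finite_verts finite_subset by blast
  then show ?thesis using assms(3)
  proof (induction rule: finite_psubset_induct)
    case (psubset T)
    have IH: "clearable x T'" if "T' \<subset> T" for T' using psubset that by blast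
    show ?case
      unfolding clearable_def
    proof (intro allI impI)
      fix l u a b r
      assume T: "T = between x l u" and terr: "territory x l u" and bd: "boundary T \<subseteq> {a, b}"
        and ab: "a \<in> pverts G" "b \<in> pverts G" and r: "r \<in> T"
      have one: "win2 a b r" if ab: "a \<in> pverts G" "b \<in> pverts G" and bd: "boundary T = {b}" for a b
      proof -
        have "x b = l \<or> x b = u" using terr bd unfolding territory_def T by blast
        then show ?thesis
        proof
          assume "x b = u"
          show ?thesis
            by (rule step_one_guard[OF inj nc terr _ ab \<open>x b = u\<close>]) (use bd IH r T in auto)
        next
          assume "x b = l"
          then have "- x b = - l" by simp
          moreover have "inj_on (\<lambda>v. - x v) (pverts G)" using inj by (simp add: inj_on_def)
          ultimately show ?thesis
            using step_one_guard[of "\<lambda>v. - x v" "- u" "- l" b a r]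
              noncrossing_uminus[OF nc] terr bd IH clearable_uminus_imp r ab
            unfolding between_uminus territory_uminus T by blast
        qed
      qed
      have "boundary T \<noteq> {}" using boundary_nonempty psubset.prems r by blast
      with bd consider "boundary T = {b}" | "boundary T = {a}" | "boundary T = {a, b}" "a \<noteq> b" by blast
      then show "win2 a b r"
      proof cases
        case 1
        then show ?thesis using one ab by blast
      next
        case 2
        then show ?thesis using one ab win2_swap by blast
      next
        case 3
        then have "x a = l \<or> x a = u" "x b = l \<or> x b = u"
          using terr unfolding territory_def T by blast+
        moreover have "x a \<noteq> x b" using 3(2) inj ab unfolding inj_on_def by blast
        ultimately consider "x a = l" "x b = u" | "x b = l" "x a = u" by auto
        then show ?thesis
        proof cases
          case 1
          show ?thesis
            by (rule step_two_guards[OF inj nc terr _ ab 1]) (use 3 IH r T in auto)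
        next
          case 2
          have "win2 b a r"
            by (rule step_two_guards[OF inj nc terr _ ab(2,1) 2]) (use 3 IH r T in auto)
          then show ?thesis by (rule win2_swap)
        qed
      qed
    qed
  qed
qed

text \<open>
  Both cops start on the last vertex of the order; the territory is the rest of the graph.
\<close>

lemma two_cops_win:
  assumes inj: "inj_on x (pverts G)" and nc: "noncrossing x (parcs G)"
    and ne: "pverts G \<noteq> {}"
  shows "\<exists>b\<in>pverts G. \<forall>r\<in>pverts G. win2 b b r"
proof -
  obtain a where a: "a \<in> pverts G" "\<forall>v\<in>pverts G. x a \<le> x v"
    using finite_has_least[OF pair_finite_verts ne] by blast
  obtain b where b: "b \<in> pverts G" "\<forall>v\<in>pverts G. x v \<le> x b"
    using finite_has_least[OF pair_finite_verts ne, of "\<lambda>v. - x v"] by auto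
  \<comment> \<open>Below the first vertex a any endpoint will do.\<close>
  have T: "between x (x a - 1) (x b) = pverts G - {b}"
    using a b inj unfolding between_def inj_on_def by (force simp: less_le)
  have bd: "boundary (pverts G - {b}) \<subseteq> {b}" using in_arcsD2 unfolding boundary_def by blast
  then have terr: "territory x (x a - 1) (x b)" unfolding territory_def T by blast
  have "pverts G - {b} \<subset> pverts G" using b(1) by blast
  then have "clearable x (pverts G - {b})" by (rule clearable_territory[OF inj nc])
  then have win: "win2 b b r" if "r \<in> pverts G - {b}" for r
    using clearableD[of x "x a - 1" "x b" b b r] terr bd b(1) that unfolding T by simp
  have "win2 b b b"
  proof (rule win2I)
    show "b \<in> closed_nbhd G b" "b \<in> closed_nbhd G b" unfolding closed_nbhd_def by simp_all
    fix r' assume "r' \<in> closed_nbhd G b" "r' \<noteq> b"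
    then show "win2 b b r'" using win in_arcsD2 unfolding closed_nbhd_def by blast
  qed
  with win b(1) show ?thesis by blast
qed

end

theorem theorem6p1:
  fixes G :: "'a pair_pre_digraph"
  assumes "pair_graph G"
    and "Digraph_Component.connected (with_proj G)"
    and "outerplanar G"
  shows "(undirected_tree G \<longrightarrow> c_cr G = 1) \<and> (\<not> undirected_tree G \<longrightarrow> c_cr G = 2)"
proof -
  interpret pair_graph G by fact
  interpret connected_pair_graph G
    using connected_imp_rtrancl[OF assms(1,2)] by unfold_locales
  have ne: "pverts G \<noteq> {}" using connected_imp_rtrancl(1)[OF assms(1,2)] .
  show ?thesis
  proof (intro conjI impI)
    assume "undirected_tree G"
    then have acyclic: "\<not> (\<exists>p. cycle p \<and> 3 \<le> length p)" unfolding undirected_tree_def by blast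
    obtain c where "c \<in> pverts G" using ne by blast
    then obtain S where "winning_strategy G 1 S"
      using cops_win_imp_winning_strategy[OF assms(1), of 1 "\<lambda>_. c"] one_cop_wins_tree[OF acyclic] by blast
    then show "c_cr G = 1" by (rule c_cr_eqI) (use zero_cops_lose[OF ne] in simp)
  next
    assume "\<not> undirected_tree G"
    then obtain p where p: "cycle p" "3 \<le> length p" using assms(2) unfolding undirected_tree_def by blast
    obtain Z where Z: "Z \<subseteq> pverts G" "Z \<noteq> {}"
      "\<forall>v\<in>Z. \<exists>a\<in>Z. \<exists>b\<in>Z. a \<noteq> b \<and> a \<noteq> v \<and> b \<noteq> v \<and> (v, a) \<in> parcs G \<and> (v, b) \<in> parcs G"
      using cycle_nbrs[OF p] .
    obtain x where x: "inj_on x (pverts G)" "noncrossing x (parcs G)"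
      using outerplanar_noncrossing[OF assms(1,3)] .
    obtain b where b: "b \<in> pverts G" "\<forall>r\<in>pverts G. win2 b b r"
      using two_cops_win[OF x ne] by blast
    obtain S where "winning_strategy G 2 S"
      using cops_win_imp_winning_strategy[OF assms(1), of 2 "\<lambda>i. if i = 0 then b else b"] b by auto
    then show "c_cr G = 2"
      by (rule c_cr_eqI) (rule robot_evades_one_cop[OF Z], simp_all)
  qed
qed

end
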